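(* Let $z,z',\xi\in\mathbb C$ with $\xi\ne1$, and let $\varphi^{\mathsf L}=\varphi^{\mathsf L}_{z,z'}$ and $\varphi^{\mathsf M}=\varphi^{\mathsf M}_{z,z',\xi}$ be the Laguerre and Meixner formal moment functionals on $\mathrm{Sym}_{\mathbb C}$. Then for every $\nu\in\mathbb Y$ $$\varphi^{\mathsf L}(S_\nu)=(z)_\nu(z')_\nu\frac{\dim\nu}{|\nu|!},\qquad \varphi^{\mathsf M}(FS_\nu)=\left(\frac{\xi}{1-\xi}\right)^{|\nu|}(z)_\nu(z')_\nu\frac{\dim\nu}{|\nu|!}.$$
   Context: $\mathbb Y$ is the set of all partitions, identified with Young diagrams; $|\nu|$ is the number of boxes and $\ell(\nu)$ the number of nonzero rows of $\nu$. $\mathrm{Sym}$ is the algebra of symmetric functions over $\mathbb R$, with power sums $p_k$ as free generators; $\mathrm{Sym}_{\mathbb C}=\mathrm{Sym}\otimes_{\mathbb R}\mathbb C$; $S_\nu$ are the Schur symmetric functions. For a box $\square=(i,j)$ (row $i$, column $j$) its content is $c(\square)=j-i$; for $\mu\subseteq\nu$, $(z)_{\nu/\mu}=\prod_{\square\in\nu/\mu}(z+c(\square))$, $(z)_\nu=(z)_{\nu/\varnothing}$; $\dim\nu/\mu$ is the number of standard tableaux of skew shape $\nu/\mu$ (equal to $1$ if $\mu=\nu$), $\dim\nu=\dim\nu/\varnothing$. Frobenius–Schur functions. Put $x^{\downarrow n}=x(x-1)\cdots(x-n+1)$. The factorial Schur polynomial is $S^{\mathsf f}_{\nu\mid N}(x_1,\dots,x_N)=\det[x_j^{\downarrow(\nu_i+N-i)}]_{i,j=1}^N/\prod_{i<j}(x_i-x_j)$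 for $\ell(\nu)\le N$ (and $0$ if $\ell(\nu)>N$). The shifted Schur polynomial is $S^*_{\nu\mid N}(y_1,\dots,y_N)=S^{\mathsf f}_{\nu\mid N}(y_1+N-1,y_2+N-2,\dots,y_N)$; it satisfies $S^*_{\nu\mid N}|_{y_N=0}=S^*_{\nu\mid N-1}$. A polynomial in $y_1,\dots,y_N$ is shifted symmetric if it is symmetric in the variables $y_i+N-i$; $\mathrm{Sym}^*$ is the algebra of sequences $(f_N)_{N\ge1}$ of shifted symmetric polynomials in $N$ variables with $f_N|_{y_N=0}=f_{N-1}$ and $\sup_N\deg f_N<\infty$. Thus $S^*_\nu=(S^*_{\nu\mid N})_N\in\mathrm{Sym}^*$. The algebra $\mathrm{Sym}^*$ is freely generated by $p_k^*=\sum_{i\ge1}[(y_i-i+\frac12)^k-(-i+\frac12)^k]$, $k\ge1$, and $FS_\nu\in\mathrm{Sym}$ is the image of $S^*_\nu$ under the algebra isomorphism $\mathrm{Sym}^*\to\mathrm{Sym}$, $p^*_k\mapsto p_k$. The $FS_\nu$ form a basis of $\mathrm{Sym}$. Laguerre and Meixner symmetric functions (each family is a basis of $\mathrm{Sym}_{\mathbb C}$): $$\mathfrak L_\nu=\sum_{\mu\subseteq\nu}(-1)^{|\nu|-|\mu|}\frac{\dim\nu/\mu}{(|\nu|-|\mu|)!}(z)_{\nu/\mu}(z')_{\nu/\mu}S_\mu,$$ $$\mathfrak M_\nu=\sum_{\mu\subseteq\nu}(-1)^{|\nu|-|\mu|}\left(\frac{\xi}{1-\xi}\right)^{|\nu|-|\mu|}\frac{\dim\nu/\mu}{(|\nu|-|\mu|)!}(z)_{\nu/\mu}(z')_{\nu/\mu}FS_\mu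 .$$ The formal moment functionals are the linear functionals $\varphi^{\mathsf L},\varphi^{\mathsf M}:\mathrm{Sym}_{\mathbb C}\to\mathbb C$ defined by $\varphi^{\mathsf L}(\mathfrak L_\nu)=\delta_{\nu\varnothing}$ and $\varphi^{\mathsf M}(\mathfrak M_\nu)=\delta_{\nu\varnothing}$ for all $\nu\in\mathbb Y$ (Kronecker delta). *)

theory Defs
  imports
    "HOL-Library.Poly_Mapping"
    "HOL-Analysis.Analysis"
    "Jordan_Normal_Form.Determinant"
begin

section \<open>Multivariate polynomials\<close>

text \<open>
  A polynomial maps monomials (finitely supported exponent vectors) to coefficients.
  Variables are numbered from \<open>0\<close>: the \<open>N\<close> variables \<open>x\<^sub>1, \<dots>, x\<^sub>N\<close> are \<open>mvar 0, \<dots>, mvar (N - 1)\<close>,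
  and rows and columns of matrices and diagrams are numbered from \<open>0\<close> as well.
\<close>

type_synonym 'a mpoly = "(nat \<Rightarrow>\<^sub>0 nat) \<Rightarrow>\<^sub>0 'a"

definition mconst :: "'a \<Rightarrow> 'a::comm_ring_1 mpoly" where
  "mconst c = Poly_Mapping.single 0 c"

definition mvar :: "nat \<Rightarrow> 'a::comm_ring_1 mpoly" where
  "mvar i = Poly_Mapping.single (Poly_Mapping.single i 1) 1"

definition mono_subst :: "(nat \<Rightarrow> 'a::comm_ring_1 mpoly) \<Rightarrow> (nat \<Rightarrow>\<^sub>0 nat) \<Rightarrow> 'a mpoly" where
  "mono_subst \<sigma> m = (\<Prod>i\<in>Poly_Mapping.keys m. \<sigma> i ^ Poly_Mapping.lookup m i)"

definition msubst :: "(nat \<Rightarrow> 'a::comm_ring_1 mpoly) \<Rightarrow> 'a mpoly \<Rightarrow> 'a mpoly" where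
  "msubst \<sigma> p = (\<Sum>m\<in>Poly_Mapping.keys p. mconst (Poly_Mapping.lookup p m) * mono_subst \<sigma> m)"

definition in_vars :: "nat \<Rightarrow> 'a::comm_ring_1 mpoly \<Rightarrow> bool" where
  "in_vars N p \<longleftrightarrow> (\<forall>m\<in>Poly_Mapping.keys p. Poly_Mapping.keys m \<subseteq> {..<N})"

definition mono_deg :: "(nat \<Rightarrow>\<^sub>0 nat) \<Rightarrow> nat" where
  "mono_deg m = (\<Sum>i\<in>Poly_Mapping.keys m. Poly_Mapping.lookup m i)"

definition deg_le :: "nat \<Rightarrow> 'a::comm_ring_1 mpoly \<Rightarrow> bool" where
  "deg_le d p \<longleftrightarrow> (\<forall>m\<in>Poly_Mapping.keys p. mono_deg m \<le> d)"

definition symmetric_poly :: "nat \<Rightarrow> 'a::comm_ring_1 mpoly \<Rightarrow> bool" where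
  "symmetric_poly N p \<longleftrightarrow> (\<forall>\<pi>. \<pi> permutes {..<N} \<longrightarrow> msubst (\<lambda>i. mvar (\<pi> i)) p = p)"

text \<open>
  With \<open>x\<^sub>i = y\<^sub>i + N - i\<close>, a polynomial in the \<open>y\<^sub>i\<close> is shifted symmetric iff the polynomial obtained by
  substituting \<open>y\<^sub>i = x\<^sub>i - (N - i)\<close> is symmetric in the \<open>x\<^sub>i\<close>.
\<close>

definition shifted_symmetric_poly :: "nat \<Rightarrow> 'a::comm_ring_1 mpoly \<Rightarrow> bool" where
  "shifted_symmetric_poly N p \<longleftrightarrow>
     symmetric_poly N (msubst (\<lambda>i. mvar i - of_nat (N - 1 - i)) p)"


subsection \<open>Substitution is a ring homomorphism\<close>

lemma mconst_simps [simp]: "mconst 0 = 0" "mconst 1 = 1"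
  by (simp_all add: mconst_def)

lemma mconst_add: "mconst (a + b) = mconst a + mconst b"
  by (simp add: mconst_def single_add)

lemma mconst_uminus: "mconst (- a) = - mconst a"
  by (simp add: mconst_def single_uminus)

lemma mconst_mult: "mconst (a * b) = mconst a * mconst b"
  by (simp add: mconst_def mult_single)

lemma of_nat_mpoly: "(of_nat n :: 'a::comm_ring_1 mpoly) = mconst (of_nat n)"
  by (simp add: mconst_def)

lemma mono_subst_superset:
  assumes "finite A" "Poly_Mapping.keys m \<subseteq> A"
  shows "mono_subst \<sigma> m = (\<Prod>i\<in>A. \<sigma> i ^ Poly_Mapping.lookup m i)"
  unfolding mono_subst_def
  by (rule prod.mono_neutral_left) (use assms in \<open>auto simp: in_keys_iff\<close>)

lemma mono_subst_add: "mono_subst \<sigma> (m + n) = mono_subst \<sigma> m * mono_subst \<sigma> n"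
proof -
  let ?A = "Poly_Mapping.keys m \<union> Poly_Mapping.keys n"
  have "mono_subst \<sigma> (m + n) = (\<Prod>i\<in>?A. \<sigma> i ^ Poly_Mapping.lookup (m + n) i)"
    by (rule mono_subst_superset) (simp_all add: keys_add)
  also have "\<dots> = (\<Prod>i\<in>?A. \<sigma> i ^ Poly_Mapping.lookup m i) * (\<Prod>i\<in>?A. \<sigma> i ^ Poly_Mapping.lookup n i)"
    by (simp add: lookup_add power_add prod.distrib)
  also have "\<dots> = mono_subst \<sigma> m * mono_subst \<sigma> n"
    by (simp add: mono_subst_superset[where A = ?A])
  finally show ?thesis .
qed

lemma mono_deg_superset:
  assumes "finite A" "Poly_Mapping.keys m \<subseteq> A"
  shows "mono_deg m = (\<Sum>i\<in>A. Poly_Mapping.lookup m i)"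
  unfolding mono_deg_def
  by (rule sum.mono_neutral_left) (use assms in \<open>auto simp: in_keys_iff\<close>)

lemma mono_deg_add: "mono_deg (m + n) = mono_deg m + mono_deg n"
proof -
  let ?A = "Poly_Mapping.keys m \<union> Poly_Mapping.keys n"
  have "mono_deg (m + n) = (\<Sum>i\<in>?A. Poly_Mapping.lookup (m + n) i)"
    by (rule mono_deg_superset) (simp_all add: keys_add)
  also have "\<dots> = mono_deg m + mono_deg n"
    by (simp add: lookup_add sum.distrib mono_deg_superset[where A = ?A])
  finally show ?thesis .
qed

lemma msubst_superset:
  assumes "finite A" "Poly_Mapping.keys p \<subseteq> A"
  shows "msubst \<sigma> p = (\<Sum>m\<in>A. mconst (Poly_Mapping.lookup p m) * mono_subst \<sigma> m)"
  unfolding msubst_def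
  by (rule sum.mono_neutral_left) (use assms in \<open>auto simp: in_keys_iff\<close>)

lemma msubst_zero [simp]: "msubst \<sigma> 0 = 0"
  by (simp add: msubst_def)

lemma msubst_add: "msubst \<sigma> (p + q) = msubst \<sigma> p + msubst \<sigma> q"
proof -
  let ?A = "Poly_Mapping.keys p \<union> Poly_Mapping.keys q"
  have "msubst \<sigma> (p + q) = (\<Sum>m\<in>?A. mconst (Poly_Mapping.lookup (p + q) m) * mono_subst \<sigma> m)"
    by (rule msubst_superset) (simp_all add: keys_add)
  also have "\<dots> = msubst \<sigma> p + msubst \<sigma> q"
    by (simp add: lookup_add mconst_add distrib_right sum.distrib msubst_superset[where A = ?A])
  finally show ?thesis .
qed

lemma msubst_uminus: "msubst \<sigma> (- p) = - msubst \<sigma> p"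
  using msubst_add[of \<sigma> "- p" p] by (simp add: eq_neg_iff_add_eq_0)

lemma msubst_diff: "msubst \<sigma> (p - q) = msubst \<sigma> p - msubst \<sigma> q"
  using msubst_add[of \<sigma> p "- q"] by (simp add: msubst_uminus)

lemma msubst_sum: "msubst \<sigma> (sum f A) = (\<Sum>x\<in>A. msubst \<sigma> (f x))"
  by (induction A rule: infinite_finite_induct) (simp_all add: msubst_add)

lemma msubst_single: "msubst \<sigma> (Poly_Mapping.single m c) = mconst c * mono_subst \<sigma> m"
  by (simp add: msubst_def)

lemma msubst_mconst [simp]: "msubst \<sigma> (mconst c) = mconst c"
  by (simp add: mconst_def msubst_single) (simp add: mono_subst_def mconst_def)

lemma msubst_one [simp]: "msubst \<sigma> 1 = 1"
  using msubst_mconst[of \<sigma> 1] by simp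

lemma msubst_of_nat [simp]: "msubst \<sigma> (of_nat n) = of_nat n"
  by (simp add: of_nat_mpoly)

lemma msubst_mvar [simp]: "msubst \<sigma> (mvar i) = \<sigma> i"
  by (simp add: mvar_def msubst_single) (simp add: mono_subst_def)

lemma mpoly_sum_monomials:
  "p = (\<Sum>m\<in>Poly_Mapping.keys p. Poly_Mapping.single m (Poly_Mapping.lookup p m))"
  by (rule poly_mapping_eqI)
     (auto simp: lookup_sum lookup_single when_def in_keys_iff sum.delta')

lemma msubst_mult: "msubst \<sigma> (p * q) = msubst \<sigma> p * msubst \<sigma> q"
proof -
  let ?P = "Poly_Mapping.keys p" and ?Q = "Poly_Mapping.keys q"
  let ?a = "Poly_Mapping.lookup p" and ?b = "Poly_Mapping.lookup q"
  have "p * q = (\<Sum>m\<in>?P. Poly_Mapping.single m (?a m)) * (\<Sum>n\<in>?Q. Poly_Mapping.single n (?b n))"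
    using mpoly_sum_monomials[of p] mpoly_sum_monomials[of q] by simp
  also have "\<dots> = (\<Sum>m\<in>?P. \<Sum>n\<in>?Q. Poly_Mapping.single (m + n) (?a m * ?b n))"
    by (simp add: sum_product mult_single)
  finally have "msubst \<sigma> (p * q)
      = (\<Sum>m\<in>?P. \<Sum>n\<in>?Q. (mconst (?a m) * mono_subst \<sigma> m) * (mconst (?b n) * mono_subst \<sigma> n))"
    by (simp add: msubst_sum msubst_single mconst_mult mono_subst_add algebra_simps)
  also have "\<dots> = msubst \<sigma> p * msubst \<sigma> q"
    by (simp add: msubst_def sum_product)
  finally show ?thesis .
qed

lemma msubst_power: "msubst \<sigma> (p ^ k) = msubst \<sigma> p ^ k"
  by (induction k) (simp_all add: msubst_mult)


subsection \<open>Closure properties\<close>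

lemma in_vars_mconst [simp]: "in_vars N (mconst c)"
  by (auto simp: in_vars_def mconst_def)

lemma in_vars_zero [simp]: "in_vars N 0" and in_vars_one [simp]: "in_vars N 1"
  by (simp_all add: in_vars_def)

lemma in_vars_mvar: "i < N \<Longrightarrow> in_vars N (mvar i)"
  by (auto simp: in_vars_def mvar_def split: if_splits)

lemma in_vars_add: "in_vars N p \<Longrightarrow> in_vars N q \<Longrightarrow> in_vars N (p + q)"
  unfolding in_vars_def using keys_add[of p q] by blast

lemma keys_uminus_mpoly: "Poly_Mapping.keys (- p) = Poly_Mapping.keys (p :: 'a::comm_ring_1 mpoly)"
  by (auto simp: in_keys_iff)

lemma in_vars_uminus: "in_vars N p \<Longrightarrow> in_vars N (- p)"
  by (simp add: in_vars_def keys_uminus_mpoly)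

lemma in_vars_diff: "in_vars N p \<Longrightarrow> in_vars N q \<Longrightarrow> in_vars N (p - q)"
  using in_vars_add[of N p "- q"] by (simp add: in_vars_uminus)

lemma in_vars_mult: "in_vars N p \<Longrightarrow> in_vars N q \<Longrightarrow> in_vars N (p * q)"
  unfolding in_vars_def
proof
  fix m assume *: "\<forall>m\<in>Poly_Mapping.keys p. Poly_Mapping.keys m \<subseteq> {..<N}"
    "\<forall>m\<in>Poly_Mapping.keys q. Poly_Mapping.keys m \<subseteq> {..<N}" and "m \<in> Poly_Mapping.keys (p * q)"
  then obtain a b where "m = a + b" "a \<in> Poly_Mapping.keys p" "b \<in> Poly_Mapping.keys q"
    using keys_mult[of p q] by blast
  with * keys_add[of a b] show "Poly_Mapping.keys m \<subseteq> {..<N}" by blast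
qed

lemma in_vars_power: "in_vars N p \<Longrightarrow> in_vars N (p ^ k)"
  by (induction k) (simp_all add: in_vars_mult)

lemma in_vars_sum: "(\<And>i. i \<in> A \<Longrightarrow> in_vars N (f i)) \<Longrightarrow> in_vars N (sum f A)"
  by (induction A rule: infinite_finite_induct) (simp_all add: in_vars_add)

lemma deg_le_mconst [simp]: "deg_le d (mconst c)"
  by (auto simp: deg_le_def mconst_def mono_deg_def)

lemma deg_le_zero [simp]: "deg_le d 0" and deg_le_one [simp]: "deg_le d 1"
  by (simp_all add: deg_le_def mono_deg_def)

lemma deg_le_mvar: "deg_le 1 (mvar i)"
  by (auto simp: deg_le_def mvar_def mono_deg_def split: if_splits)

lemma deg_le_mono: "deg_le d p \<Longrightarrow> d \<le> e \<Longrightarrow> deg_le e p"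
  by (auto simp: deg_le_def)

lemma deg_le_add: "deg_le d p \<Longrightarrow> deg_le e q \<Longrightarrow> deg_le (max d e) (p + q)"
  unfolding deg_le_def using keys_add[of p q] by (fastforce simp: le_max_iff_disj)

lemma deg_le_uminus: "deg_le d p \<Longrightarrow> deg_le d (- p)"
  by (simp add: deg_le_def keys_uminus_mpoly)

lemma deg_le_diff: "deg_le d p \<Longrightarrow> deg_le e q \<Longrightarrow> deg_le (max d e) (p - q)"
  using deg_le_add[of d p e "- q"] by (simp add: deg_le_uminus)

lemma deg_le_mult: "deg_le d p \<Longrightarrow> deg_le e q \<Longrightarrow> deg_le (d + e) (p * q)"
  unfolding deg_le_def
proof
  fix m assume *: "\<forall>m\<in>Poly_Mapping.keys p. mono_deg m \<le> d" "\<forall>m\<in>Poly_Mapping.keys q. mono_deg m \<le> e"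
    and "m \<in> Poly_Mapping.keys (p * q)"
  then obtain a b where "m = a + b" "a \<in> Poly_Mapping.keys p" "b \<in> Poly_Mapping.keys q"
    using keys_mult[of p q] by blast
  with * show "mono_deg m \<le> d + e" by (simp add: mono_deg_add add_mono)
qed

lemma deg_le_power: "deg_le d p \<Longrightarrow> deg_le (k * d) (p ^ k)"
proof (induction k)
  case (Suc k)
  then show ?case using deg_le_mult[of d p "k * d" "p ^ k"] by simp
qed simp

lemma deg_le_sum: "(\<And>i. i \<in> A \<Longrightarrow> deg_le d (f i)) \<Longrightarrow> deg_le d (sum f A)"
proof (induction A rule: infinite_finite_induct)
  case (insert x F)
  then show ?case using deg_le_add[of d "f x" d "sum f F"] by simp
qed simp_all

lemma symmetric_poly_mconst [simp]: "symmetric_poly N (mconst c)"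
  and symmetric_poly_zero [simp]: "symmetric_poly N 0"
  and symmetric_poly_one [simp]: "symmetric_poly N 1"
  and symmetric_poly_add: "symmetric_poly N p \<Longrightarrow> symmetric_poly N q \<Longrightarrow> symmetric_poly N (p + q)"
  and symmetric_poly_diff: "symmetric_poly N p \<Longrightarrow> symmetric_poly N q \<Longrightarrow> symmetric_poly N (p - q)"
  and symmetric_poly_uminus: "symmetric_poly N p \<Longrightarrow> symmetric_poly N (- p)"
  and symmetric_poly_mult: "symmetric_poly N p \<Longrightarrow> symmetric_poly N q \<Longrightarrow> symmetric_poly N (p * q)"
  by (simp_all add: symmetric_poly_def msubst_add msubst_diff msubst_uminus msubst_mult)

lemma symmetric_poly_sum_vars:
  "symmetric_poly N (\<Sum>i<N. (mvar i + mconst a) ^ k)"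
proof -
  have "(\<Sum>i<N. (mvar (\<pi> i) + mconst a) ^ k) = (\<Sum>i<N. (mvar i + mconst a :: 'a::comm_ring_1 mpoly) ^ k)"
    if "\<pi> permutes {..<N}" for \<pi>
    using sum.permute[OF that, of "\<lambda>i. (mvar i + mconst a :: 'a mpoly) ^ k"] by (simp add: o_def)
  then show ?thesis
    by (simp add: symmetric_poly_def msubst_sum msubst_power msubst_add)
qed

lemma symmetric_poly_sum:
  "(\<And>i. i \<in> A \<Longrightarrow> symmetric_poly N (f i)) \<Longrightarrow> symmetric_poly N (sum f A)"
  by (induction A rule: infinite_finite_induct) (simp_all add: symmetric_poly_add)

lemma shifted_symmetric_poly_simps [simp]:
  "shifted_symmetric_poly N (mconst c)" "shifted_symmetric_poly N 0" "shifted_symmetric_poly N 1"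
  and shifted_symmetric_poly_add:
    "shifted_symmetric_poly N p \<Longrightarrow> shifted_symmetric_poly N q \<Longrightarrow> shifted_symmetric_poly N (p + q)"
  and shifted_symmetric_poly_diff:
    "shifted_symmetric_poly N p \<Longrightarrow> shifted_symmetric_poly N q \<Longrightarrow> shifted_symmetric_poly N (p - q)"
  and shifted_symmetric_poly_uminus:
    "shifted_symmetric_poly N p \<Longrightarrow> shifted_symmetric_poly N (- p)"
  and shifted_symmetric_poly_mult:
    "shifted_symmetric_poly N p \<Longrightarrow> shifted_symmetric_poly N q \<Longrightarrow> shifted_symmetric_poly N (p * q)"
  by (simp_all add: shifted_symmetric_poly_def msubst_add msubst_diff msubst_uminus msubst_mult
      symmetric_poly_add symmetric_poly_diff symmetric_poly_uminus symmetric_poly_mult)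


section \<open>The algebras of symmetric and shifted symmetric functions\<close>

text \<open>
  Sequences \<open>(f\<^sub>N)\<close> of polynomials in \<open>N\<close> variables, compatible with \<open>x\<^sub>N = 0\<close> and of bounded degree.
  The additional term \<open>f\<^sub>0\<close> is the constant obtained from \<open>f\<^sub>1\<close> by setting its only variable to \<open>0\<close>,
  hence carries no information.
\<close>

definition stable_seq :: "(nat \<Rightarrow> 'a::comm_ring_1 mpoly) \<Rightarrow> bool" where
  "stable_seq f \<longleftrightarrow>
     (\<forall>N. in_vars N (f N)) \<and>
     (\<forall>N. msubst (mvar(N := 0)) (f (Suc N)) = f N) \<and>
     (\<exists>d. \<forall>N. deg_le d (f N))"

lemma stable_seq_mconst [simp]: "stable_seq (\<lambda>N. mconst c)"
  and stable_seq_zero [simp]: "stable_seq (\<lambda>N. 0)"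
  and stable_seq_one [simp]: "stable_seq (\<lambda>N. 1)"
  by (auto simp: stable_seq_def)

lemma stable_seq_add: "stable_seq f \<Longrightarrow> stable_seq g \<Longrightarrow> stable_seq (\<lambda>N. f N + g N)"
  unfolding stable_seq_def by (auto simp: in_vars_add msubst_add) (blast intro: deg_le_add)

lemma stable_seq_diff: "stable_seq f \<Longrightarrow> stable_seq g \<Longrightarrow> stable_seq (\<lambda>N. f N - g N)"
  unfolding stable_seq_def by (auto simp: in_vars_diff msubst_diff) (blast intro: deg_le_diff)

lemma stable_seq_uminus: "stable_seq f \<Longrightarrow> stable_seq (\<lambda>N. - f N)"
  unfolding stable_seq_def by (auto simp: in_vars_uminus msubst_uminus) (blast intro: deg_le_uminus)

lemma stable_seq_mult: "stable_seq f \<Longrightarrow> stable_seq g \<Longrightarrow> stable_seq (\<lambda>N. f N * g N)"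
  unfolding stable_seq_def by (auto simp: in_vars_mult msubst_mult) (blast intro: deg_le_mult)

typedef (overloaded) 'a::comm_ring_1 sym =
  "{f :: nat \<Rightarrow> 'a mpoly. stable_seq f \<and> (\<forall>N. symmetric_poly N (f N))}"
  morphisms sym_poly Abs_sym
  by (rule exI[of _ "\<lambda>_. 0"]) simp

typedef (overloaded) 'a::comm_ring_1 shifted_sym =
  "{f :: nat \<Rightarrow> 'a mpoly. stable_seq f \<and> (\<forall>N. shifted_symmetric_poly N (f N))}"
  morphisms shifted_sym_poly Abs_shifted_sym
  by (rule exI[of _ "\<lambda>_. 0"]) simp

setup_lifting type_definition_sym
setup_lifting type_definition_shifted_sym

instantiation sym :: (comm_ring_1) comm_ring_1
begin

lift_definition zero_sym :: "'a sym" is "\<lambda>N. 0" by simp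
lift_definition one_sym :: "'a sym" is "\<lambda>N. 1" by simp
lift_definition plus_sym :: "'a sym \<Rightarrow> 'a sym \<Rightarrow> 'a sym" is "\<lambda>f g N. f N + g N"
  by (simp add: stable_seq_add symmetric_poly_add)
lift_definition minus_sym :: "'a sym \<Rightarrow> 'a sym \<Rightarrow> 'a sym" is "\<lambda>f g N. f N - g N"
  by (simp add: stable_seq_diff symmetric_poly_diff)
lift_definition uminus_sym :: "'a sym \<Rightarrow> 'a sym" is "\<lambda>f N. - f N"
  by (simp add: stable_seq_uminus symmetric_poly_uminus)
lift_definition times_sym :: "'a sym \<Rightarrow> 'a sym \<Rightarrow> 'a sym" is "\<lambda>f g N. f N * g N"
  by (simp add: stable_seq_mult symmetric_poly_mult)

instance
  by standard (transfer; auto simp: algebra_simps dest: fun_cong)+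

end

instantiation shifted_sym :: (comm_ring_1) comm_ring_1
begin

lift_definition zero_shifted_sym :: "'a shifted_sym" is "\<lambda>N. 0" by simp
lift_definition one_shifted_sym :: "'a shifted_sym" is "\<lambda>N. 1" by simp
lift_definition plus_shifted_sym :: "'a shifted_sym \<Rightarrow> 'a shifted_sym \<Rightarrow> 'a shifted_sym"
  is "\<lambda>f g N. f N + g N"
  by (simp add: stable_seq_add shifted_symmetric_poly_add)
lift_definition minus_shifted_sym :: "'a shifted_sym \<Rightarrow> 'a shifted_sym \<Rightarrow> 'a shifted_sym"
  is "\<lambda>f g N. f N - g N"
  by (simp add: stable_seq_diff shifted_symmetric_poly_diff)
lift_definition uminus_shifted_sym :: "'a shifted_sym \<Rightarrow> 'a shifted_sym" is "\<lambda>f N. - f N"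
  by (simp add: stable_seq_uminus shifted_symmetric_poly_uminus)
lift_definition times_shifted_sym :: "'a shifted_sym \<Rightarrow> 'a shifted_sym \<Rightarrow> 'a shifted_sym"
  is "\<lambda>f g N. f N * g N"
  by (simp add: stable_seq_mult shifted_symmetric_poly_mult)

instance
  by standard (transfer; auto simp: algebra_simps dest: fun_cong)+

end

lift_definition sym_scale :: "'a::comm_ring_1 \<Rightarrow> 'a sym \<Rightarrow> 'a sym" is "\<lambda>c f N. mconst c * f N"
  by (simp add: stable_seq_mult symmetric_poly_mult)

lift_definition shifted_sym_scale :: "'a::comm_ring_1 \<Rightarrow> 'a shifted_sym \<Rightarrow> 'a shifted_sym"
  is "\<lambda>c f N. mconst c * f N"
  by (simp add: stable_seq_mult shifted_symmetric_poly_mult)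

lemma vector_space_sym: "vector_space (sym_scale :: 'a::field \<Rightarrow> 'a sym \<Rightarrow> 'a sym)"
  by standard (transfer; simp add: algebra_simps mconst_add mconst_mult)+

text \<open>
  \<open>Sym\<^sub>\<complex> = Sym \<otimes>\<^sub>\<real> \<complex>\<close> is the algebra \<open>complex sym\<close> of symmetric functions with complex coefficients; the map
  \<open>f \<mapsto> f \<otimes> 1\<close> reads real coefficients as complex ones.
\<close>

lemma lookup_map_of_real:
  "Poly_Mapping.lookup (Poly_Mapping.map complex_of_real p) m = of_real (Poly_Mapping.lookup p m)"
  by (simp add: Poly_Mapping.map.rep_eq when_def)

lemma keys_map_of_real [simp]:
  "Poly_Mapping.keys (Poly_Mapping.map complex_of_real p) = Poly_Mapping.keys p"
  by (auto simp: in_keys_iff lookup_map_of_real)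

lemma map_of_real_add: "Poly_Mapping.map complex_of_real (p + q)
    = Poly_Mapping.map complex_of_real p + Poly_Mapping.map complex_of_real q"
  by (rule poly_mapping_eqI) (simp add: lookup_map_of_real lookup_add)

lemma map_of_real_zero [simp]: "Poly_Mapping.map complex_of_real 0 = 0"
  by (rule poly_mapping_eqI) (simp add: lookup_map_of_real)

lemma map_of_real_sum: "Poly_Mapping.map complex_of_real (sum f A)
    = (\<Sum>x\<in>A. Poly_Mapping.map complex_of_real (f x))"
  by (induction A rule: infinite_finite_induct)
     (simp_all add: map_of_real_add)

lemma map_of_real_mult: "Poly_Mapping.map complex_of_real ((p :: real mpoly) * q)
    = Poly_Mapping.map complex_of_real p * Poly_Mapping.map complex_of_real q"
proof -
  let ?P = "Poly_Mapping.keys p" and ?Q = "Poly_Mapping.keys q"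
  let ?a = "Poly_Mapping.lookup p" and ?b = "Poly_Mapping.lookup q"
  have "p * q = (\<Sum>m\<in>?P. Poly_Mapping.single m (?a m)) * (\<Sum>n\<in>?Q. Poly_Mapping.single n (?b n))"
    using mpoly_sum_monomials[of p] mpoly_sum_monomials[of q] by simp
  also have "\<dots> = (\<Sum>m\<in>?P. \<Sum>n\<in>?Q. Poly_Mapping.single (m + n) (?a m * ?b n))"
    by (simp add: sum_product mult_single)
  finally have "Poly_Mapping.map complex_of_real (p * q)
    = (\<Sum>m\<in>?P. Poly_Mapping.single m (complex_of_real (?a m)))
      * (\<Sum>n\<in>?Q. Poly_Mapping.single n (complex_of_real (?b n)))"
    by (simp add: map_of_real_sum sum_product mult_single)
  also have "\<dots> = Poly_Mapping.map complex_of_real p * Poly_Mapping.map complex_of_real q"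
    using mpoly_sum_monomials[of "Poly_Mapping.map complex_of_real p"]
      mpoly_sum_monomials[of "Poly_Mapping.map complex_of_real q"]
    by (simp add: lookup_map_of_real)
  finally show ?thesis .
qed

lemma map_of_real_one [simp]: "Poly_Mapping.map complex_of_real (1 :: real mpoly) = 1"
  by (rule poly_mapping_eqI) (simp add: lookup_map_of_real lookup_one when_def)

lemma map_of_real_mvar [simp]: "Poly_Mapping.map complex_of_real (mvar i :: real mpoly) = mvar i"
  by (simp add: mvar_def)

lemma map_of_real_mconst: "Poly_Mapping.map complex_of_real (mconst c :: real mpoly) = mconst (of_real c)"
  by (simp add: mconst_def)

lemma map_of_real_power: "Poly_Mapping.map complex_of_real ((p :: real mpoly) ^ k)
    = Poly_Mapping.map complex_of_real p ^ k"
  by (induction k) (simp_all add: map_of_real_mult)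

lemma map_of_real_prod: "Poly_Mapping.map complex_of_real (prod (f :: 'b \<Rightarrow> real mpoly) A)
    = (\<Prod>x\<in>A. Poly_Mapping.map complex_of_real (f x))"
  by (induction A rule: infinite_finite_induct) (simp_all add: map_of_real_mult)

lemma map_of_real_msubst: "Poly_Mapping.map complex_of_real (msubst \<sigma> p)
    = msubst (\<lambda>i. Poly_Mapping.map complex_of_real (\<sigma> i)) (Poly_Mapping.map complex_of_real p)"
  by (simp add: msubst_def mono_subst_def map_of_real_sum map_of_real_mult map_of_real_prod
      map_of_real_power map_of_real_mconst lookup_map_of_real)

lift_definition sym_complexify :: "real sym \<Rightarrow> complex sym"
  is "\<lambda>f N. Poly_Mapping.map complex_of_real (f N)"
proof (intro CollectI conjI allI, goal_cases)
  case (1 f)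
  have "msubst (mvar(N := 0)) (Poly_Mapping.map complex_of_real (f (Suc N)))
        = Poly_Mapping.map complex_of_real (f N)" for N
  proof -
    have eq: "(\<lambda>i. Poly_Mapping.map complex_of_real ((mvar(N := 0)) i)) = mvar(N := 0)"
      by (simp add: fun_eq_iff)
    show ?thesis
      using 1 map_of_real_msubst[of "mvar(N := 0)" "f (Suc N)"] unfolding eq
      by (simp add: stable_seq_def)
  qed
  with 1 show ?case by (auto simp: stable_seq_def in_vars_def deg_le_def)
next
  case (2 f N)
  show ?case unfolding symmetric_poly_def
  proof (intro allI impI)
    fix \<pi> assume "\<pi> permutes {..<N}"
    with 2 have "msubst (\<lambda>i. mvar (\<pi> i)) (f N) = f N" by (simp add: symmetric_poly_def)
    with map_of_real_msubst[of "\<lambda>i. mvar (\<pi> i)" "f N"]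
    show "msubst (\<lambda>i. mvar (\<pi> i)) (Poly_Mapping.map complex_of_real (f N))
        = Poly_Mapping.map complex_of_real (f N)" by simp
  qed
qed


section \<open>Power sums and the isomorphism between the two algebras\<close>

text \<open>Only \<open>k \<ge> 1\<close> is meaningful: \<open>\<Sum>\<^sub>i x\<^sub>i\<^sup>0\<close> is not stable.\<close>

lift_definition power_sum :: "nat \<Rightarrow> real sym" is
  "\<lambda>k N. if k = 0 then 0 else \<Sum>i<N. mvar i ^ k"
proof (goal_cases)
  case (1 k)
  have "stable_seq (\<lambda>N. \<Sum>i<N. mvar i ^ k :: real mpoly)" if "k > 0"
    unfolding stable_seq_def
    using that deg_le_power[OF deg_le_mvar, of k]
    by (auto simp: msubst_sum msubst_power msubst_add zero_power
        intro!: in_vars_sum in_vars_power in_vars_mvar deg_le_sum exI[of _ k])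
  then show ?case using symmetric_poly_sum_vars[of _ "0::real" k] by (cases "k = 0") simp_all
qed

text \<open>\<open>p\<^sub>k\<^sup>* = \<Sum>\<^sub>i [(y\<^sub>i - i + 1/2)\<^sup>k - (-i + 1/2)\<^sup>k]\<close>; the \<open>i\<close> of the formula is \<open>i + 1\<close> below.\<close>

lift_definition shifted_power_sum :: "nat \<Rightarrow> real shifted_sym" is
  "\<lambda>k N. \<Sum>i<N. (mvar i + mconst (1/2 - real (i + 1))) ^ k - mconst (1/2 - real (i + 1)) ^ k"
proof (intro CollectI conjI allI, goal_cases)
  case (1 k)
  have "deg_le k ((mvar i + mconst c) ^ k - mconst c ^ k :: real mpoly)" for i c
  proof -
    have "deg_le 1 (mvar i + mconst c :: real mpoly)"
      using deg_le_add[OF deg_le_mvar, of 0 "mconst c" i] by simp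
    from deg_le_diff[OF deg_le_power[OF this, of k], of 0 "mconst c ^ k"] show ?thesis
      using deg_le_power[of 0 "mconst c" k] by simp
  qed
  then have "\<forall>N. deg_le k (\<Sum>i<N. (mvar i + mconst (1/2 - real (i + 1))) ^ k - mconst (1/2 - real (i + 1)) ^ k)"
    by (blast intro: deg_le_sum)
  then show ?case unfolding stable_seq_def
    by (auto simp: msubst_sum msubst_power msubst_add msubst_diff
        intro!: in_vars_sum in_vars_diff in_vars_power in_vars_add in_vars_mvar)
next
  case (2 k N)
  let ?s = "\<lambda>i. mvar i - of_nat (N - 1 - i) :: real mpoly"
  have eq: "?s i + mconst (1/2 - real (i + 1)) = mvar i + mconst (1/2 - real N)" if "i < N" for i
  proof -
    have "1/2 - real (i + 1) = (1/2 - real N) + real (N - 1 - i)"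
      using that by (simp add: of_nat_diff)
    then have "mconst (1/2 - real (i + 1)) = mconst (1/2 - real N) + (of_nat (N - 1 - i) :: real mpoly)"
      by (simp only: mconst_add of_nat_mpoly)
    moreover have "(v - c) + (b + c) = v + b" for v b c :: "real mpoly"
      by (simp add: algebra_simps)
    ultimately show ?thesis by (simp only:)
  qed
  have "msubst ?s (\<Sum>i<N. (mvar i + mconst (1/2 - real (i + 1))) ^ k - mconst (1/2 - real (i + 1)) ^ k)
      = (\<Sum>i<N. (?s i + mconst (1/2 - real (i + 1))) ^ k - mconst (1/2 - real (i + 1)) ^ k)"
    by (simp add: msubst_sum msubst_power msubst_add msubst_diff)
  also have "\<dots> = (\<Sum>i<N. (mvar i + mconst (1/2 - real N)) ^ k) - (\<Sum>i<N. mconst (1/2 - real (i + 1)) ^ k)"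
    unfolding sum_subtractf[symmetric] by (rule sum.cong) (simp_all only: eq lessThan_iff)
  finally have *: "msubst ?s (\<Sum>i<N. (mvar i + mconst (1/2 - real (i + 1))) ^ k - mconst (1/2 - real (i + 1)) ^ k)
      = (\<Sum>i<N. (mvar i + mconst (1/2 - real N)) ^ k) - (\<Sum>i<N. mconst (1/2 - real (i + 1)) ^ k)" .
  have "symmetric_poly N (mconst c ^ k :: real mpoly)" for c
    by (simp add: symmetric_poly_def msubst_power)
  then show ?case unfolding shifted_symmetric_poly_def *
    by (intro symmetric_poly_diff symmetric_poly_sum_vars symmetric_poly_sum)
qed

definition shifted_algebra_iso :: "(real shifted_sym \<Rightarrow> real sym) \<Rightarrow> bool" where
  "shifted_algebra_iso \<Phi> \<longleftrightarrow>
     bij \<Phi> \<and> \<Phi> 1 = 1 \<and>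
     (\<forall>f g. \<Phi> (f + g) = \<Phi> f + \<Phi> g) \<and>
     (\<forall>f g. \<Phi> (f * g) = \<Phi> f * \<Phi> g) \<and>
     (\<forall>c f. \<Phi> (shifted_sym_scale c f) = sym_scale c (\<Phi> f))"

text \<open>Existence and uniqueness: the \<open>p\<^sub>k\<^sup>*\<close> and the \<open>p\<^sub>k\<close>, \<open>k \<ge> 1\<close>, are free generators.\<close>

definition shifted_to_sym :: "real shifted_sym \<Rightarrow> real sym" where
  "shifted_to_sym = (THE \<Phi>. shifted_algebra_iso \<Phi> \<and> (\<forall>k\<ge>1. \<Phi> (shifted_power_sum k) = power_sum k))"


section \<open>Partitions and skew diagrams\<close>

text \<open>A partition is the list of its nonzero rows; its length is the number of nonzero rows.\<close>

definition is_partition :: "nat list \<Rightarrow> bool" where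
  "is_partition \<nu> \<longleftrightarrow> sorted_wrt (\<ge>) \<nu> \<and> 0 \<notin> set \<nu>"

definition nth_row :: "nat list \<Rightarrow> nat \<Rightarrow> nat" where
  "nth_row \<nu> i = (if i < length \<nu> then \<nu> ! i else 0)"

definition diagram :: "nat list \<Rightarrow> (nat \<times> nat) set" where
  "diagram \<nu> = {(i, j). j < nth_row \<nu> i}"

definition subpartitions :: "nat list \<Rightarrow> nat list set" where
  "subpartitions \<nu> = {\<mu>. is_partition \<mu> \<and> diagram \<mu> \<subseteq> diagram \<nu>}"

text \<open>The content is unaffected by numbering both rows and columns from \<open>0\<close>.\<close>

definition content_prod :: "complex \<Rightarrow> nat list \<Rightarrow> nat list \<Rightarrow> complex" where
  "content_prod z \<nu> \<mu> = (\<Prod>(i, j)\<in>diagram \<nu> - diagram \<mu>. z + of_int (int j - int i))"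

text \<open>
  Standard tableaux of shape \<open>\<nu>/\<mu>\<close>: bijective fillings of the boxes by \<open>1, \<dots>, |\<nu>| - |\<mu>|\<close> that increase along
  rows and columns, extended by \<open>undefined\<close> outside the shape so that they can be counted.
\<close>

definition standard_tableaux :: "nat list \<Rightarrow> nat list \<Rightarrow> (nat \<times> nat \<Rightarrow> nat) set" where
  "standard_tableaux \<nu> \<mu> =
     {T \<in> extensional (diagram \<nu> - diagram \<mu>).
        bij_betw T (diagram \<nu> - diagram \<mu>) {1..sum_list \<nu> - sum_list \<mu>} \<and>
        (\<forall>i j j'. (i, j) \<in> diagram \<nu> - diagram \<mu> \<longrightarrow> (i, j') \<in> diagram \<nu> - diagram \<mu> \<longrightarrow>
           j < j' \<longrightarrow> T (i, j) < T (i, j')) \<and>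
        (\<forall>i i' j. (i, j) \<in> diagram \<nu> - diagram \<mu> \<longrightarrow> (i', j) \<in> diagram \<nu> - diagram \<mu> \<longrightarrow>
           i < i' \<longrightarrow> T (i, j) < T (i', j))}"

definition skew_dim :: "nat list \<Rightarrow> nat list \<Rightarrow> nat" where
  "skew_dim \<nu> \<mu> = card (standard_tableaux \<nu> \<mu>)"

lemma finite_diagram: "finite (diagram \<nu>)"
proof (rule finite_subset)
  show "diagram \<nu> \<subseteq> (SIGMA i:{..<length \<nu>}. {..<\<nu> ! i})"
    by (auto simp: diagram_def nth_row_def split: if_splits)
qed auto

lemma diagram_inj:
  assumes "is_partition \<mu>" "is_partition \<nu>" "diagram \<mu> = diagram \<nu>"
  shows "\<mu> = \<nu>"
proof -
  have row: "nth_row \<mu> i = nth_row \<nu> i" for i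
  proof -
    have "(i, j) \<in> diagram \<mu> \<longleftrightarrow> (i, j) \<in> diagram \<nu>" for j
      using assms(3) by simp
    then have "j < nth_row \<mu> i \<longleftrightarrow> j < nth_row \<nu> i" for j
      by (simp add: diagram_def)
    then show ?thesis by (meson less_irrefl linorder_neqE_nat)
  qed
  have pos: "nth_row \<kappa> i > 0 \<longleftrightarrow> i < length \<kappa>" if "is_partition \<kappa>" for \<kappa> i
    using that nth_mem[of i \<kappa>] by (auto simp: nth_row_def is_partition_def intro!: gr0I simp del: nth_mem)
  have "i < length \<mu> \<longleftrightarrow> i < length \<nu>" for i
    using row pos assms(1,2) by metis
  then have len: "length \<mu> = length \<nu>" by (meson less_irrefl linorder_neqE_nat)
  show ?thesis
  proof (rule nth_equalityI)
    fix i assume "i < length \<mu>"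
    with row[of i] len show "\<mu> ! i = \<nu> ! i" by (simp add: nth_row_def)
  qed (fact len)
qed

lemma finite_subpartitions: "finite (subpartitions \<nu>)"
proof (rule inj_on_finite)
  show "inj_on diagram (subpartitions \<nu>)"
    by (auto simp: inj_on_def subpartitions_def diagram_inj)
  show "diagram ` subpartitions \<nu> \<subseteq> Pow (diagram \<nu>)"
    by (auto simp: subpartitions_def)
  show "finite (Pow (diagram \<nu>))"
    by (simp add: finite_diagram)
qed

lemma finite_standard_tableaux: "finite (standard_tableaux \<nu> \<mu>)"
proof (rule finite_subset)
  show "standard_tableaux \<nu> \<mu> \<subseteq>
      PiE (diagram \<nu> - diagram \<mu>) (\<lambda>_. {1..sum_list \<nu> - sum_list \<mu>})"
    by (auto simp: standard_tableaux_def bij_betw_def PiE_def)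
qed (simp add: finite_PiE finite_diagram)


section \<open>Schur and Frobenius--Schur functions\<close>

text \<open>
  \<open>det [a\<^sub>i\<^sub>j] / \<Prod>\<^bsub>i<j\<^esub> (x\<^sub>i - x\<^sub>j)\<close> as a polynomial. It is unique because polynomials form an integral domain, and it exists
  when \<open>a\<^sub>i\<^sub>j = g\<^sub>i(x\<^sub>j)\<close>, since the determinant is then antisymmetric. The exponents \<open>\<nu>\<^sub>i + N - i\<close> used below appear
  as \<open>nth_row \<nu> i + N - 1 - i\<close>, where no truncation occurs because \<open>i < N\<close>.
\<close>

definition alternant_quotient :: "nat \<Rightarrow> (nat \<Rightarrow> nat \<Rightarrow> real mpoly) \<Rightarrow> real mpoly" where
  "alternant_quotient N a =
     (THE q. q * (\<Prod>j<N. \<Prod>i<j. mvar i - mvar j) = det (mat N N (\<lambda>(i, j). a i j)))"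

definition schur_poly :: "nat list \<Rightarrow> nat \<Rightarrow> real mpoly" where
  "schur_poly \<nu> N =
     (if length \<nu> \<le> N
      then alternant_quotient N (\<lambda>i j. mvar j ^ (nth_row \<nu> i + N - 1 - i))
      else 0)"

text \<open>The sequences of polynomials passed to \<open>Abs_sym\<close> and \<open>Abs_shifted_sym\<close> are stable and (shifted) symmetric.\<close>

definition schur :: "nat list \<Rightarrow> real sym" where
  "schur \<nu> = Abs_sym (schur_poly \<nu>)"

definition falling :: "'a::comm_ring_1 \<Rightarrow> nat \<Rightarrow> 'a" where
  "falling x n = (\<Prod>k<n. x - of_nat k)"

definition factorial_schur_poly :: "nat list \<Rightarrow> nat \<Rightarrow> real mpoly" where
  "factorial_schur_poly \<nu> N =
     (if length \<nu> \<le> N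
      then alternant_quotient N (\<lambda>i j. falling (mvar j) (nth_row \<nu> i + N - 1 - i))
      else 0)"

definition shifted_schur_poly :: "nat list \<Rightarrow> nat \<Rightarrow> real mpoly" where
  "shifted_schur_poly \<nu> N =
     msubst (\<lambda>j. mvar j + of_nat (N - 1 - j)) (factorial_schur_poly \<nu> N)"

definition shifted_schur :: "nat list \<Rightarrow> real shifted_sym" where
  "shifted_schur \<nu> = Abs_shifted_sym (shifted_schur_poly \<nu>)"

definition frobenius_schur :: "nat list \<Rightarrow> real sym" where
  "frobenius_schur \<nu> = shifted_to_sym (shifted_schur \<nu>)"


section \<open>Laguerre and Meixner symmetric functions and their moment functionals\<close>

definition laguerre_sym :: "complex \<Rightarrow> complex \<Rightarrow> nat list \<Rightarrow> complex sym" where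
  "laguerre_sym z z' \<nu> =
     (\<Sum>\<mu>\<in>subpartitions \<nu>.
        sym_scale ((-1) ^ (sum_list \<nu> - sum_list \<mu>)
            * (of_nat (skew_dim \<nu> \<mu>) / fact (sum_list \<nu> - sum_list \<mu>))
            * content_prod z \<nu> \<mu> * content_prod z' \<nu> \<mu>)
          (sym_complexify (schur \<mu>)))"

definition meixner_sym :: "complex \<Rightarrow> complex \<Rightarrow> complex \<Rightarrow> nat list \<Rightarrow> complex sym" where
  "meixner_sym z z' \<xi> \<nu> =
     (\<Sum>\<mu>\<in>subpartitions \<nu>.
        sym_scale ((-1) ^ (sum_list \<nu> - sum_list \<mu>)
            * (\<xi> / (1 - \<xi>)) ^ (sum_list \<nu> - sum_list \<mu>)
            * (of_nat (skew_dim \<nu> \<mu>) / fact (sum_list \<nu> - sum_list \<mu>))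
            * content_prod z \<nu> \<mu> * content_prod z' \<nu> \<mu>)
          (sym_complexify (frobenius_schur \<mu>)))"

text \<open>
  Each of the families is a basis of \<open>Sym\<^sub>\<complex>\<close>, so for given parameters the predicates below are satisfied by
  exactly one functional.
\<close>

definition laguerre_moment_functional ::
    "complex \<Rightarrow> complex \<Rightarrow> (complex sym \<Rightarrow> complex) \<Rightarrow> bool" where
  "laguerre_moment_functional z z' \<phi> \<longleftrightarrow>
     Vector_Spaces.linear sym_scale (*) \<phi> \<and>
     (\<forall>\<nu>. is_partition \<nu> \<longrightarrow> \<phi> (laguerre_sym z z' \<nu>) = (if \<nu> = [] then 1 else 0))"

definition meixner_moment_functional ::
    "complex \<Rightarrow> complex \<Rightarrow> complex \<Rightarrow> (complex sym \<Rightarrow> complex) \<Rightarrow> bool" where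
  "meixner_moment_functional z z' \<xi> \<phi> \<longleftrightarrow>
     Vector_Spaces.linear sym_scale (*) \<phi> \<and>
     (\<forall>\<nu>. is_partition \<nu> \<longrightarrow> \<phi> (meixner_sym z z' \<xi> \<nu>) = (if \<nu> = [] then 1 else 0))"

end

theory Submission
  imports Defs
begin

text \<open>
  Both formulas are instances of a triangular inversion. Write \<open>t = 1\<close> (Laguerre) or
  \<open>t = \<xi> / (1 - \<xi>)\<close> (Meixner), and let \<open>f\<^sub>\<mu>\<close> be \<open>S\<^sub>\<mu>\<close> or \<open>FS\<^sub>\<mu>\<close>. The coefficient of \<open>f\<^sub>\<nu>\<close> in the
  Laguerre or Meixner function indexed by \<open>\<nu>\<close> is \<open>1\<close>, so the values of the moment functional determine
  its values on the \<open>f\<^sub>\<nu>\<close> by induction on \<open>|\<nu>|\<close>; no property of the functions \<open>f\<^sub>\<mu>\<close> themselves is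
  involved. It remains to check that the claimed values
  \<open>F\<^sub>\<mu> = t\<^bsup>|\<mu>|\<^esup> (z)\<^sub>\<mu> (z')\<^sub>\<mu> dim \<mu> / |\<mu>|!\<close> solve the triangular system. Since
  \<open>(z)\<^bsub>\<nu>/\<mu>\<^esub> (z)\<^sub>\<mu> = (z)\<^sub>\<nu>\<close>, inserting them gives, with \<open>n = |\<nu>|\<close>,
  \<open>t\<^sup>n (z)\<^sub>\<nu> (z')\<^sub>\<nu> \<Sum>\<^bsub>\<mu> \<subseteq> \<nu>\<^esub> (-1)\<^bsup>n - |\<mu>|\<^esup> dim \<nu>/\<mu> dim \<mu> / ((n - |\<mu>|)! |\<mu>|!)\<close>.
  The branching rule \<open>\<Sum>\<^bsub>|\<mu>| = k\<^esub> dim \<nu>/\<mu> dim \<mu> = dim \<nu>\<close> (lemma \<open>skew_dim_branching\<close>) turns the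
  sum into \<open>dim \<nu> / n!\<close> times the binomial expansion of \<open>(1 - 1)\<^sup>n\<close>; this power vanishes unless \<open>\<nu>\<close> is empty.

  The branching rule is a statement about arbitrary finite relations (lemma
  \<open>card_increasing_fillings_split\<close>): cutting an increasing filling by \<open>1, \<dots>, n\<close> after the value \<open>k\<close> yields
  a down-closed set of size \<open>k\<close> together with increasing fillings of it and of its complement. For a
  Young diagram the down-closed subsets are the diagrams of the partitions contained in it.
\<close>

section \<open>Increasing fillings of a finite set with a relation\<close>

text \<open>
  Bijective fillings of \<open>D\<close> by \<open>1, \<dots>, |D|\<close> that increase along the relation \<open>R\<close>, made
  \<open>undefined\<close> outside \<open>D\<close>; for a partial order these are its linear extensions.
\<close>

definition increasing_fillings :: "('b \<Rightarrow> 'b \<Rightarrow> bool) \<Rightarrow> 'b set \<Rightarrow> ('b \<Rightarrow> nat) set" where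
  "increasing_fillings R D =
     {T \<in> extensional D. bij_betw T D {1..card D} \<and> (\<forall>a\<in>D. \<forall>b\<in>D. R a b \<longrightarrow> T a < T b)}"

text \<open>The subset \<open>I\<close> of \<open>D\<close> contains with each element also its \<open>R\<close>-predecessors in \<open>D\<close>.\<close>

definition down_closed_in :: "('b \<Rightarrow> 'b \<Rightarrow> bool) \<Rightarrow> 'b set \<Rightarrow> 'b set \<Rightarrow> bool" where
  "down_closed_in R D I \<longleftrightarrow> I \<subseteq> D \<and> (\<forall>a\<in>D. \<forall>b\<in>I. R a b \<longrightarrow> a \<in> I)"

lemma finite_increasing_fillings:
  assumes "finite D"
  shows "finite (increasing_fillings R D)"
proof (rule finite_subset)
  show "increasing_fillings R D \<subseteq> PiE D (\<lambda>_. {1..card D})"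
    by (auto simp: increasing_fillings_def bij_betw_def PiE_def)
qed (simp add: finite_PiE assms)

lemma increasing_fillings_empty: "increasing_fillings R {} = {\<lambda>_. undefined}"
  by (auto simp: increasing_fillings_def bij_betw_def)

text \<open>Cutting a numbering after the value \<open>k\<close> and renumbering the second part.\<close>

lemma bij_betw_cut:
  fixes T :: "'b \<Rightarrow> nat"
  assumes "bij_betw T D {1..n}" "k \<le> n"
  shows "bij_betw T {b \<in> D. T b \<le> k} {1..k}"
    and "bij_betw (\<lambda>b. T b - k) (D - {b \<in> D. T b \<le> k}) {1..n - k}"
proof -
  have im: "T ` D = {1..n}" and inj: "inj_on T D"
    using assms(1) by (auto simp: bij_betw_def)
  have range: "1 \<le> T b \<and> T b \<le> n" if "b \<in> D" for b
    using im that by auto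
  have hit: "\<exists>b\<in>D. T b = v" if "1 \<le> v" "v \<le> n" for v
  proof -
    have "v \<in> T ` D" using that im by simp
    then show ?thesis by auto
  qed
  show "bij_betw T {b \<in> D. T b \<le> k} {1..k}"
    unfolding bij_betw_def
  proof (intro conjI equalityI subsetI)
    show "inj_on T {b \<in> D. T b \<le> k}"
      using inj by (rule inj_on_subset) auto
    show "v \<in> T ` {b \<in> D. T b \<le> k}" if "v \<in> {1..k}" for v
      using hit[of v] that assms(2) by auto
  qed (use range in auto)
  show "bij_betw (\<lambda>b. T b - k) (D - {b \<in> D. T b \<le> k}) {1..n - k}"
    unfolding bij_betw_def
  proof (intro conjI equalityI subsetI)
    show "inj_on (\<lambda>b. T b - k) (D - {b \<in> D. T b \<le> k})"
      using inj by (auto simp: inj_on_def eq_diff_iff)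
    show "v \<in> (\<lambda>b. T b - k) ` (D - {b \<in> D. T b \<le> k})" if "v \<in> {1..n - k}" for v
    proof -
      from that assms(2) have "1 \<le> v + k" "v + k \<le> n" by auto
      then obtain b where "b \<in> D" "T b = v + k"
        using hit by blast
      with that show ?thesis by (intro image_eqI[of _ _ b]) auto
    qed
    show "v \<in> {1..n - k}" if "v \<in> (\<lambda>b. T b - k) ` (D - {b \<in> D. T b \<le> k})" for v
      using that range by (force intro: diff_le_mono)
  qed
qed

text \<open>
  The filling of \<open>D\<close> obtained from a filling \<open>U\<close> of \<open>I \<subseteq> D\<close> and a filling \<open>V\<close> of \<open>D - I\<close>: the values of
  \<open>V\<close> are shifted by \<open>|I|\<close>, so that they come after those of \<open>U\<close>.
\<close>

definition glue_fillings :: "'b set \<Rightarrow> 'b set \<Rightarrow> ('b \<Rightarrow> nat) \<times> ('b \<Rightarrow> nat) \<Rightarrow> 'b \<Rightarrow> nat" where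
  "glue_fillings D I =
     (\<lambda>(U, V). restrict (\<lambda>b. if b \<in> I then U b else V b + card I) D)"

text \<open>
  The fillings of \<open>D\<close> whose values up to \<open>|I|\<close> occupy exactly \<open>I\<close> are the glued ones. Gluing preserves
  monotonicity because \<open>I\<close> is down-closed: no element of \<open>D - I\<close> precedes an element of \<open>I\<close>.
\<close>

lemma bij_betw_glue_fillings:
  assumes fin: "finite D" and down: "down_closed_in R D I"
  shows "bij_betw (glue_fillings D I)
           (increasing_fillings R I \<times> increasing_fillings R (D - I))
           {T \<in> increasing_fillings R D. {b \<in> D. T b \<le> card I} = I}"
proof (rule bij_betw_byWitness[where
      f' = "\<lambda>T. (restrict T I, restrict (\<lambda>b. T b - card I) (D - I))"])
  let ?k = "card I"
  have ID: "I \<subseteq> D" and dc: "\<And>a b. a \<in> D \<Longrightarrow> b \<in> I \<Longrightarrow> R a b \<Longrightarrow> a \<in> I"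
    using down by (auto simp: down_closed_in_def)
  have kn: "?k \<le> card D" using ID fin by (rule card_mono[rotated])
  have cD: "card (D - I) = card D - ?k"
    using ID fin by (simp add: card_Diff_subset finite_subset)
  show "\<forall>p\<in>increasing_fillings R I \<times> increasing_fillings R (D - I).
      (restrict (glue_fillings D I p) I,
       restrict (\<lambda>b. glue_fillings D I p b - ?k) (D - I)) = p"
  proof
    fix p assume "p \<in> increasing_fillings R I \<times> increasing_fillings R (D - I)"
    then obtain U V where p: "p = (U, V)" and "U \<in> extensional I" "V \<in> extensional (D - I)"
      by (auto simp: increasing_fillings_def)
    moreover from this ID have "restrict (glue_fillings D I p) I = U"
      by (intro extensionalityI[of _ I]) (auto simp: glue_fillings_def)
    moreover from calculation have "restrict (\<lambda>b. glue_fillings D I p b - ?k) (D - I) = V"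
      by (intro extensionalityI[of _ "D - I"]) (auto simp: glue_fillings_def)
    ultimately show "(restrict (glue_fillings D I p) I,
       restrict (\<lambda>b. glue_fillings D I p b - ?k) (D - I)) = p" by simp
  qed
  show "\<forall>T\<in>{T \<in> increasing_fillings R D. {b \<in> D. T b \<le> ?k} = I}.
      glue_fillings D I (restrict T I, restrict (\<lambda>b. T b - ?k) (D - I)) = T"
  proof safe
    fix T assume T: "T \<in> increasing_fillings R D" and cut: "{b \<in> D. T b \<le> ?k} = I"
    have "?k \<le> T b" if "b \<in> D" "b \<notin> I" for b
      using that cut by (metis (mono_tags, lifting) mem_Collect_eq nat_le_linear)
    with T show "glue_fillings D I (restrict T I, restrict (\<lambda>b. T b - ?k) (D - I)) = T"
      by (intro extensionalityI[of _ D]) (auto simp: glue_fillings_def increasing_fillings_def)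
  qed
  show "glue_fillings D I ` (increasing_fillings R I \<times> increasing_fillings R (D - I))
      \<subseteq> {T \<in> increasing_fillings R D. {b \<in> D. T b \<le> ?k} = I}"
  proof clarify
    fix U V assume U: "U \<in> increasing_fillings R I" and V: "V \<in> increasing_fillings R (D - I)"
    let ?T = "glue_fillings D I (U, V)"
    have bU: "bij_betw U I {1..?k}"
      and incU: "\<And>a b. a \<in> I \<Longrightarrow> b \<in> I \<Longrightarrow> R a b \<Longrightarrow> U a < U b"
      using U by (auto simp: increasing_fillings_def)
    have bV: "bij_betw V (D - I) {1..card D - ?k}"
      and incV: "\<And>a b. a \<in> D - I \<Longrightarrow> b \<in> D - I \<Longrightarrow> R a b \<Longrightarrow> V a < V b"
      using V by (auto simp: increasing_fillings_def cD)
    have TI: "?T b = U b" "U b \<le> ?k" if "b \<in> I" for b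
      using that ID bij_betwE[OF bU] by (auto simp: glue_fillings_def)
    have TV: "?T b = V b + ?k" "1 \<le> V b" if "b \<in> D - I" for b
      using that bij_betwE[OF bV] by (auto simp: glue_fillings_def)
    have "bij_betw ?T I {1..?k}"
      using bU by (subst bij_betw_cong[of I ?T U]) (auto simp: TI)
    moreover have "bij_betw ?T (D - I) {?k + 1..card D}"
    proof -
      have "bij_betw (\<lambda>v. v + ?k) {1..card D - ?k} {?k + 1..card D}"
        by (rule bij_betw_byWitness[of _ "\<lambda>v. v - ?k"]) (use kn in auto)
      from bij_betw_trans[OF bV this] show ?thesis
        by (subst bij_betw_cong[of _ ?T "(\<lambda>v. v + ?k) \<circ> V"]) (simp_all add: TV)
    qed
    ultimately have "bij_betw ?T (I \<union> (D - I)) ({1..?k} \<union> {?k + 1..card D})"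
      by (rule bij_betw_combine) auto
    moreover have "I \<union> (D - I) = D" "{1..?k} \<union> {?k + 1..card D} = {1..card D}"
      using ID kn by auto
    ultimately have "bij_betw ?T D {1..card D}" by simp
    moreover have "?T a < ?T b" if "a \<in> D" "b \<in> D" "R a b" for a b
    proof (cases "b \<in> I")
      case True
      with dc that have "a \<in> I" by blast
      with True that incU show ?thesis by (simp add: TI)
    next
      case b: False
      show ?thesis
      proof (cases "a \<in> I")
        case True
        with b that TI[of a] TV[of b] show ?thesis by simp
      next
        case False
        with b that incV[of a b] show ?thesis by (simp add: TV)
      qed
    qed
    moreover have "?T \<in> extensional D" by (simp add: glue_fillings_def)
    moreover have "b \<in> I \<longleftrightarrow> ?T b \<le> ?k" if "b \<in> D" for b
      using that TI[of b] TV[of b] by (cases "b \<in> I") auto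
    ultimately show "?T \<in> increasing_fillings R D \<and> {b \<in> D. ?T b \<le> ?k} = I"
      using ID by (auto simp: increasing_fillings_def)
  qed
  show "(\<lambda>T. (restrict T I, restrict (\<lambda>b. T b - ?k) (D - I)))
      ` {T \<in> increasing_fillings R D. {b \<in> D. T b \<le> ?k} = I}
      \<subseteq> increasing_fillings R I \<times> increasing_fillings R (D - I)"
  proof clarify
    fix T assume T: "T \<in> increasing_fillings R D" and cut: "{b \<in> D. T b \<le> ?k} = I"
    have bT: "bij_betw T D {1..card D}"
      and inc: "\<And>a b. a \<in> D \<Longrightarrow> b \<in> D \<Longrightarrow> R a b \<Longrightarrow> T a < T b"
      using T by (auto simp: increasing_fillings_def)
    have "?k < T b" if "b \<in> D - I" for b
      using that cut by (metis (mono_tags, lifting) DiffE mem_Collect_eq not_less)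
    then have "T a - ?k < T b - ?k" if "a \<in> D - I" "b \<in> D - I" "R a b" for a b
      using that inc[of a b] by (simp add: diff_less_mono less_imp_le)
    moreover have "bij_betw (\<lambda>b. T b - ?k) (D - I) {1..card (D - I)}"
      using bij_betw_cut(2)[OF bT kn] by (simp add: cut cD)
    moreover have "bij_betw T I {1..?k}"
      using bij_betw_cut(1)[OF bT kn] by (simp add: cut)
    ultimately show "restrict T I \<in> increasing_fillings R I \<and>
        restrict (\<lambda>b. T b - ?k) (D - I) \<in> increasing_fillings R (D - I)"
      using inc[OF subsetD[OF ID] subsetD[OF ID]]
      by (simp add: increasing_fillings_def)
  qed
qed

text \<open>Classify the increasing fillings of \<open>D\<close> by the set of elements that receive the values up to \<open>k\<close>.\<close>

lemma card_increasing_fillings_split: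
  assumes fin: "finite D" and k: "k \<le> card D"
  shows "card (increasing_fillings R D) =
    (\<Sum>I | down_closed_in R D I \<and> card I = k.
       card (increasing_fillings R (D - I)) * card (increasing_fillings R I))"
proof -
  let ?S = "{I. down_closed_in R D I \<and> card I = k}"
  let ?F = "\<lambda>I. {T \<in> increasing_fillings R D. {b \<in> D. T b \<le> k} = I}"
  have finS: "finite ?S"
    by (rule finite_subset[of _ "Pow D"]) (auto simp: down_closed_in_def fin)
  have "{b \<in> D. T b \<le> k} \<in> ?S" if "T \<in> increasing_fillings R D" for T
  proof -
    from that have "bij_betw T D {1..card D}"
      by (simp add: increasing_fillings_def)
    from bij_betw_same_card[OF bij_betw_cut(1)[OF this k]]
    have "card {b \<in> D. T b \<le> k} = k" by simp
    moreover have "down_closed_in R D {b \<in> D. T b \<le> k}"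
      using that unfolding down_closed_in_def increasing_fillings_def by fastforce
    ultimately show ?thesis by simp
  qed
  then have "increasing_fillings R D = (\<Union>I\<in>?S. ?F I)" by blast
  then have "card (increasing_fillings R D) = card (\<Union>I\<in>?S. ?F I)" by simp
  also have "\<dots> = (\<Sum>I\<in>?S. card (?F I))"
    by (rule card_UN_disjoint[OF finS])
       (auto simp: finite_increasing_fillings[OF fin] finite_subset)
  also have "\<dots> = (\<Sum>I\<in>?S. card (increasing_fillings R (D - I)) * card (increasing_fillings R I))"
  proof (rule sum.cong)
    fix I assume "I \<in> ?S"
    with bij_betw_same_card[OF bij_betw_glue_fillings[OF fin, of R I]]
    show "card (?F I) = card (increasing_fillings R (D - I)) * card (increasing_fillings R I)"
      by (simp add: card_cartesian_product mult.commute)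
  qed simp
  finally show ?thesis .
qed


section \<open>Young diagrams and the branching rule\<close>

lemma diagram_Nil [simp]: "diagram [] = {}"
  by (simp add: diagram_def nth_row_def)

lemma card_diagram: "card (diagram \<nu>) = sum_list \<nu>"
proof -
  have "diagram \<nu> = (SIGMA i:{..<length \<nu>}. {..<\<nu> ! i})"
    by (auto simp: diagram_def nth_row_def split: if_splits)
  then show ?thesis
    by (simp add: card_SigmaI sum_list_sum_nth lessThan_atLeast0)
qed

lemma nth_row_antimono:
  assumes "is_partition \<nu>" "i \<le> i'"
  shows "nth_row \<nu> i' \<le> nth_row \<nu> i"
  using assms sorted_wrt_nth_less[of "(\<ge>)" \<nu> i i']
  by (cases "i = i'") (auto simp: nth_row_def is_partition_def)

text \<open>A box precedes the boxes to its right in its row and those below it in its column.\<close>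

definition box_before :: "nat \<times> nat \<Rightarrow> nat \<times> nat \<Rightarrow> bool" where
  "box_before a b \<longleftrightarrow>
     (fst a = fst b \<and> snd a < snd b) \<or> (snd a = snd b \<and> fst a < fst b)"

lemma standard_tableaux_eq:
  assumes "diagram \<mu> \<subseteq> diagram \<nu>"
  shows "standard_tableaux \<nu> \<mu> = increasing_fillings box_before (diagram \<nu> - diagram \<mu>)"
proof -
  have "card (diagram \<nu> - diagram \<mu>) = sum_list \<nu> - sum_list \<mu>"
    using assms by (simp add: card_Diff_subset finite_diagram card_diagram)
  then show ?thesis
    unfolding standard_tableaux_def increasing_fillings_def box_before_def by auto
qed

lemma skew_dim_eq:
  "diagram \<mu> \<subseteq> diagram \<nu> \<Longrightarrow>
     skew_dim \<nu> \<mu> = card (increasing_fillings box_before (diagram \<nu> - diagram \<mu>))"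
  by (simp add: skew_dim_def standard_tableaux_eq)

lemma skew_dim_self: "skew_dim \<nu> \<nu> = 1"
  by (simp add: skew_dim_eq increasing_fillings_empty)

lemma down_closed_nat_set:
  fixes A :: "nat set"
  assumes "finite A" "\<And>i j. j \<in> A \<Longrightarrow> i < j \<Longrightarrow> i \<in> A"
  shows "A = {..<card A}"
proof -
  have "\<exists>m. A = {..<m}"
  proof (cases "A = {}")
    case False
    have "i \<in> A" if "i \<le> Max A" for i
      using that assms(2)[of "Max A" i] Max_in[OF assms(1) False] by (cases "i = Max A") auto
    then have "A = {..<Suc (Max A)}"
      using assms(1) by (auto simp: less_Suc_eq_le)
    then show ?thesis ..
  qed (auto intro: exI[of _ 0])
  then show ?thesis by auto
qed

text \<open>
  The partition is read off from the row lengths \<open>r i\<close> of \<open>I\<close>; the length \<open>m\<close> of the first column is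
  the number of its nonempty rows.
\<close>

lemma down_closed_diagram_ex_partition:
  assumes \<nu>: "is_partition \<nu>" and I: "down_closed_in box_before (diagram \<nu>) I"
  shows "\<exists>\<mu>. is_partition \<mu> \<and> diagram \<mu> = I"
proof -
  have sub: "I \<subseteq> diagram \<nu>" and fin: "finite I"
    using I finite_subset[OF _ finite_diagram] by (auto simp: down_closed_in_def)
  have dc: "a \<in> I" if "a \<in> diagram \<nu>" "b \<in> I" "box_before a b" for a b
    using I that by (auto simp: down_closed_in_def)
  have left: "(i, j') \<in> I" if "(i, j) \<in> I" "j' < j" for i j j'
  proof -
    have "(i, j') \<in> diagram \<nu>" using that sub by (auto simp: diagram_def)
    moreover have "box_before (i, j') (i, j)" using that by (simp add: box_before_def)
    ultimately show ?thesis using dc that(1) by blast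
  qed
  have up: "(i', j) \<in> I" if "(i, j) \<in> I" "i' < i" for i i' j
  proof -
    have "(i, j) \<in> diagram \<nu>" using that sub by blast
    then have "(i', j) \<in> diagram \<nu>"
      using that nth_row_antimono[OF \<nu>, of i' i] by (simp add: diagram_def)
    moreover have "box_before (i', j) (i, j)" using that by (simp add: box_before_def)
    ultimately show ?thesis using dc that(1) by blast
  qed
  define r where "r i = card {j. (i, j) \<in> I}" for i
  define m where "m = card {i. (i, 0) \<in> I}"
  have finrow: "finite {j. (i, j) \<in> I}" for i
    by (rule finite_subset[OF _ finite_imageI[OF fin, of snd]]) force
  have row: "(i, j) \<in> I \<longleftrightarrow> j < r i" for i j
    using down_closed_nat_set[OF finrow[of i]] left unfolding r_def by blast
  have "finite {i. (i, 0) \<in> I}"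
    by (rule finite_subset[OF _ finite_imageI[OF fin, of fst]]) force
  then have col: "(i, 0) \<in> I \<longleftrightarrow> i < m" for i
    using down_closed_nat_set[of "{i. (i, 0) \<in> I}"] up unfolding m_def by blast
  have r_pos: "0 < r i \<longleftrightarrow> i < m" for i
    using row col by blast
  have r_mono: "r i' \<le> r i" if "i < i'" for i i'
    using row up[OF _ that] by (meson leI less_irrefl)
  have "r i \<noteq> 0" if "i < m" for i
    using r_pos[of i] that by simp
  then have "0 \<notin> set (map r [0..<m])" by fastforce
  with r_mono have "is_partition (map r [0..<m])"
    by (simp add: is_partition_def sorted_wrt_iff_nth_less)
  moreover have "diagram (map r [0..<m]) = I"
  proof -
    have "nth_row (map r [0..<m]) i = r i" for i
      using r_pos[of i] by (auto simp: nth_row_def)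
    then show ?thesis using row by (auto simp: diagram_def)
  qed
  ultimately show ?thesis by blast
qed

lemma down_closed_in_diagram:
  assumes "is_partition \<mu>" "diagram \<mu> \<subseteq> diagram \<nu>"
  shows "down_closed_in box_before (diagram \<nu>) (diagram \<mu>)"
proof -
  have "(i, j) \<in> diagram \<mu>" if "(i', j') \<in> diagram \<mu>" "box_before (i, j) (i', j')" for i j i' j'
    using that nth_row_antimono[OF assms(1), of i i'] by (auto simp: box_before_def diagram_def)
  with assms(2) show ?thesis by (auto simp: down_closed_in_def)
qed

text \<open>
  Of the boxes of a standard tableau of shape \<open>\<nu>\<close>, those with entries up to \<open>k\<close> form a partition \<open>\<mu>\<close> of
  size \<open>k\<close>, and the remaining entries form a standard tableau of shape \<open>\<nu>/\<mu>\<close>.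
\<close>

lemma skew_dim_branching:
  assumes \<nu>: "is_partition \<nu>" and k: "k \<le> sum_list \<nu>"
  shows "(\<Sum>\<mu> | \<mu> \<in> subpartitions \<nu> \<and> sum_list \<mu> = k. skew_dim \<nu> \<mu> * skew_dim \<mu> [])
    = skew_dim \<nu> []"
proof -
  let ?D = "diagram \<nu>"
  let ?c = "\<lambda>E. card (increasing_fillings box_before E)"
  have "skew_dim \<nu> [] = ?c ?D"
    by (simp add: skew_dim_eq)
  also have "\<dots> = (\<Sum>I | down_closed_in box_before ?D I \<and> card I = k. ?c (?D - I) * ?c I)"
    using k by (intro card_increasing_fillings_split) (simp_all add: finite_diagram card_diagram)
  also have "\<dots> = (\<Sum>\<mu> | \<mu> \<in> subpartitions \<nu> \<and> sum_list \<mu> = k. ?c (?D - diagram \<mu>) * ?c (diagram \<mu>))"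
  proof (rule sum.reindex_bij_betw[symmetric], unfold bij_betw_def, intro conjI equalityI subsetI)
    show "inj_on diagram {\<mu>. \<mu> \<in> subpartitions \<nu> \<and> sum_list \<mu> = k}"
      by (auto simp: inj_on_def subpartitions_def diagram_inj)
    show "I \<in> diagram ` {\<mu>. \<mu> \<in> subpartitions \<nu> \<and> sum_list \<mu> = k}"
      if "I \<in> {I. down_closed_in box_before ?D I \<and> card I = k}" for I
    proof -
      from that down_closed_diagram_ex_partition[OF \<nu>] obtain \<mu>
        where "is_partition \<mu>" "diagram \<mu> = I" by blast
      with that show ?thesis
        by (auto simp: subpartitions_def down_closed_in_def card_diagram intro!: image_eqI[of _ _ \<mu>])
    qed
  qed (auto simp: subpartitions_def card_diagram down_closed_in_diagram)
  also have "\<dots> = (\<Sum>\<mu> | \<mu> \<in> subpartitions \<nu> \<and> sum_list \<mu> = k. skew_dim \<nu> \<mu> * skew_dim \<mu> [])"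
    by (rule sum.cong) (auto simp: skew_dim_eq subpartitions_def)
  finally show ?thesis by simp
qed

lemma content_prod_mult:
  assumes "\<mu> \<in> subpartitions \<nu>"
  shows "content_prod z \<nu> \<mu> * content_prod z \<mu> [] = content_prod z \<nu> []"
proof -
  have "diagram \<mu> \<subseteq> diagram \<nu>" using assms by (simp add: subpartitions_def)
  then show ?thesis
    unfolding content_prod_def diagram_Nil Diff_empty
    by (rule prod.subset_diff[OF _ finite_diagram, symmetric])
qed

lemma sum_list_subpartition_le:
  assumes "\<mu> \<in> subpartitions \<nu>"
  shows "sum_list \<mu> \<le> sum_list \<nu>"
  using assms card_mono[OF finite_diagram, of "diagram \<mu>" \<nu>]
  by (simp add: subpartitions_def card_diagram)

lemma sum_list_proper_subpartition_less:
  assumes "is_partition \<nu>" "\<mu> \<in> subpartitions \<nu>" "\<mu> \<noteq> \<nu>"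
  shows "sum_list \<mu> < sum_list \<nu>"
proof -
  have "diagram \<mu> \<subset> diagram \<nu>"
    using assms by (auto simp: subpartitions_def dest: diagram_inj)
  from psubset_card_mono[OF finite_diagram this] show ?thesis by (simp add: card_diagram)
qed


section \<open>Inverting the triangular system\<close>

text \<open>
  The coefficient of \<open>S\<^sub>\<mu>\<close> in the Laguerre function (\<open>t = 1\<close>) and of \<open>FS\<^sub>\<mu>\<close> in the Meixner function
  (\<open>t = \<xi> / (1 - \<xi>)\<close>) indexed by \<open>\<nu>\<close>, for \<open>\<mu> \<subseteq> \<nu>\<close>.
\<close>

definition expansion_coeff :: "complex \<Rightarrow> complex \<Rightarrow> complex \<Rightarrow> nat list \<Rightarrow> nat list \<Rightarrow> complex" where
  "expansion_coeff t z z' \<nu> \<mu> =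
     (-1) ^ (sum_list \<nu> - sum_list \<mu>) * t ^ (sum_list \<nu> - sum_list \<mu>)
       * (of_nat (skew_dim \<nu> \<mu>) / fact (sum_list \<nu> - sum_list \<mu>))
       * content_prod z \<nu> \<mu> * content_prod z' \<nu> \<mu>"

text \<open>The claimed value of the moment functional on \<open>S\<^sub>\<nu>\<close> or \<open>FS\<^sub>\<nu>\<close>.\<close>

definition moment_value :: "complex \<Rightarrow> complex \<Rightarrow> complex \<Rightarrow> nat list \<Rightarrow> complex" where
  "moment_value t z z' \<nu> =
     t ^ sum_list \<nu> * content_prod z \<nu> [] * content_prod z' \<nu> []
       * (of_nat (skew_dim \<nu> []) / fact (sum_list \<nu>))"

lemma expansion_coeff_self: "expansion_coeff t z z' \<nu> \<nu> = 1"
  by (simp add: expansion_coeff_def skew_dim_self content_prod_def)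

lemma sum_alternating_inverse_factorials:
  "(\<Sum>k\<le>n. (-1) ^ (n - k) / (fact (n - k) * fact k) :: complex) = (if n = 0 then 1 else 0)"
proof -
  have "(\<Sum>k\<le>n. (-1) ^ (n - k) / (fact (n - k) * fact k) :: complex)
      = (\<Sum>k\<le>n. of_nat (n choose k) * 1 ^ k * (-1) ^ (n - k)) / fact n"
    unfolding sum_divide_distrib
    by (rule sum.cong) (simp_all add: binomial_fact field_simps)
  also have "(\<Sum>k\<le>n. of_nat (n choose k) * 1 ^ k * (-1) ^ (n - k)) = (1 + (-1) :: complex) ^ n"
    by (rule binomial_ring[symmetric])
  finally show ?thesis by (simp add: power_0_left)
qed

lemma expansion_coeff_moment_value:
  assumes \<nu>: "is_partition \<nu>"
  shows "(\<Sum>\<mu>\<in>subpartitions \<nu>. expansion_coeff t z z' \<nu> \<mu> * moment_value t z z' \<mu>)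
    = (if \<nu> = [] then 1 else 0)"
proof -
  let ?n = "sum_list \<nu>"
  let ?C = "t ^ ?n * content_prod z \<nu> [] * content_prod z' \<nu> []"
  let ?w = "\<lambda>k. (-1) ^ (?n - k) / (fact (?n - k) * fact k) :: complex"
  let ?d = "\<lambda>\<mu>. of_nat (skew_dim \<nu> \<mu> * skew_dim \<mu> []) :: complex"
  have "(\<Sum>\<mu>\<in>subpartitions \<nu>. expansion_coeff t z z' \<nu> \<mu> * moment_value t z z' \<mu>)
      = (\<Sum>\<mu>\<in>subpartitions \<nu>. ?C * (?w (sum_list \<mu>) * ?d \<mu>))"
  proof (rule sum.cong)
    fix \<mu> assume \<mu>: "\<mu> \<in> subpartitions \<nu>"
    have "t ^ ?n = t ^ (?n - sum_list \<mu>) * t ^ sum_list \<mu>"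
      using sum_list_subpartition_le[OF \<mu>] by (simp flip: power_add)
    then show "expansion_coeff t z z' \<nu> \<mu> * moment_value t z z' \<mu>
        = ?C * (?w (sum_list \<mu>) * ?d \<mu>)"
      by (simp add: expansion_coeff_def moment_value_def flip: content_prod_mult[OF \<mu>])
  qed simp
  also have "\<dots> = ?C * (\<Sum>\<mu>\<in>subpartitions \<nu>. ?w (sum_list \<mu>) * ?d \<mu>)"
    by (simp only: sum_distrib_left)
  also have "(\<Sum>\<mu>\<in>subpartitions \<nu>. ?w (sum_list \<mu>) * ?d \<mu>)
      = (\<Sum>k\<le>?n. \<Sum>\<mu> | \<mu> \<in> subpartitions \<nu> \<and> sum_list \<mu> = k. ?w (sum_list \<mu>) * ?d \<mu>)"
    by (rule sum.group[symmetric])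
       (auto simp: finite_subpartitions sum_list_subpartition_le)
  also have "\<dots> = (\<Sum>k\<le>?n. ?w k * of_nat (skew_dim \<nu> []))"
  proof (rule sum.cong)
    fix k assume "k \<in> {..?n}"
    then have "of_nat (skew_dim \<nu> [])
        = (\<Sum>\<mu> | \<mu> \<in> subpartitions \<nu> \<and> sum_list \<mu> = k. ?d \<mu>)"
      using skew_dim_branching[OF \<nu>, of k, symmetric] by (simp only: of_nat_sum atMost_iff)
    then show "(\<Sum>\<mu> | \<mu> \<in> subpartitions \<nu> \<and> sum_list \<mu> = k. ?w (sum_list \<mu>) * ?d \<mu>)
        = ?w k * of_nat (skew_dim \<nu> [])"
      by (simp add: sum_distrib_left)
  qed simp
  also have "\<dots> = (if ?n = 0 then 1 else 0) * of_nat (skew_dim \<nu> [])"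
    by (simp only: sum_distrib_right[symmetric] sum_alternating_inverse_factorials)
  finally have *: "(\<Sum>\<mu>\<in>subpartitions \<nu>. expansion_coeff t z z' \<nu> \<mu> * moment_value t z z' \<mu>)
      = ?C * ((if ?n = 0 then 1 else 0) * of_nat (skew_dim \<nu> []))" .
  have "?n = 0 \<longleftrightarrow> \<nu> = []"
    using \<nu> by (cases \<nu>) (auto simp: is_partition_def)
  with * show ?thesis
    by (cases "\<nu> = []") (simp_all add: content_prod_def skew_dim_self del: sum_list_eq_0_iff)
qed

text \<open>
  The expansion coefficients are unitriangular with respect to \<open>|\<nu>|\<close>, so the system in
  \<open>sys\<close> has at most one solution.
\<close>

lemma moment_value_unique:
  assumes sys: "\<And>\<nu>. is_partition \<nu> \<Longrightarrow>
      (\<Sum>\<mu>\<in>subpartitions \<nu>. expansion_coeff t z z' \<nu> \<mu> * g \<mu>) = (if \<nu> = [] then 1 else 0)"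
    and "is_partition \<nu>"
  shows "g \<nu> = moment_value t z z' \<nu>"
  using assms(2)
proof (induction \<nu> rule: measure_induct_rule[of sum_list])
  case (less \<nu>)
  have mem: "\<nu> \<in> subpartitions \<nu>" using less.prems by (simp add: subpartitions_def)
  have split: "(\<Sum>\<mu>\<in>subpartitions \<nu>. expansion_coeff t z z' \<nu> \<mu> * h \<mu>)
      = h \<nu> + (\<Sum>\<mu>\<in>subpartitions \<nu> - {\<nu>}. expansion_coeff t z z' \<nu> \<mu> * h \<mu>)" for h
    using sum.remove[OF finite_subpartitions mem, of "\<lambda>\<mu>. expansion_coeff t z z' \<nu> \<mu> * h \<mu>"]
    by (simp add: expansion_coeff_self)
  have "(\<Sum>\<mu>\<in>subpartitions \<nu> - {\<nu>}. expansion_coeff t z z' \<nu> \<mu> * g \<mu>)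
      = (\<Sum>\<mu>\<in>subpartitions \<nu> - {\<nu>}. expansion_coeff t z z' \<nu> \<mu> * moment_value t z z' \<mu>)"
  proof (rule sum.cong)
    fix \<mu> assume "\<mu> \<in> subpartitions \<nu> - {\<nu>}"
    then have "sum_list \<mu> < sum_list \<nu>" "is_partition \<mu>"
      using sum_list_proper_subpartition_less[OF less.prems] by (auto simp: subpartitions_def)
    then show "expansion_coeff t z z' \<nu> \<mu> * g \<mu> = expansion_coeff t z z' \<nu> \<mu> * moment_value t z z' \<mu>"
      using less.IH by simp
  qed simp
  with split[of g] split[of "moment_value t z z'"] sys[OF less.prems]
    expansion_coeff_moment_value[OF less.prems, of t z z']
  show ?case by simp
qed

lemma linear_functional_moment_value:
  fixes \<phi> :: "complex sym \<Rightarrow> complex"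
  assumes lin: "Vector_Spaces.linear sym_scale (*) \<phi>"
    and val: "\<And>\<nu>. is_partition \<nu> \<Longrightarrow>
      \<phi> (\<Sum>\<mu>\<in>subpartitions \<nu>. sym_scale (expansion_coeff t z z' \<nu> \<mu>) (f \<mu>))
        = (if \<nu> = [] then 1 else 0)"
    and "is_partition \<nu>"
  shows "\<phi> (f \<nu>) = moment_value t z z' \<nu>"
proof (rule moment_value_unique[OF _ assms(3)])
  interpret Vector_Spaces.linear sym_scale "(*)" \<phi> by (fact lin)
  fix \<kappa> assume "is_partition \<kappa>"
  from val[OF this]
  show "(\<Sum>\<mu>\<in>subpartitions \<kappa>. expansion_coeff t z z' \<kappa> \<mu> * \<phi> (f \<mu>)) = (if \<kappa> = [] then 1 else 0)"
    by (simp add: sum scale)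
qed

theorem proposition5p2:
  fixes z z' \<xi> :: complex
    and \<phi>L \<phi>M :: "complex sym \<Rightarrow> complex"
    and \<nu> :: "nat list"
  assumes "\<xi> \<noteq> 1"
    and "laguerre_moment_functional z z' \<phi>L"
    and "meixner_moment_functional z z' \<xi> \<phi>M"
    and "is_partition \<nu>"
  shows "\<phi>L (sym_complexify (schur \<nu>)) =
           content_prod z \<nu> [] * content_prod z' \<nu> [] *
           (of_nat (skew_dim \<nu> []) / fact (sum_list \<nu>)) \<and>
         \<phi>M (sym_complexify (frobenius_schur \<nu>)) =
           (\<xi> / (1 - \<xi>)) ^ sum_list \<nu> *
           content_prod z \<nu> [] * content_prod z' \<nu> [] *
           (of_nat (skew_dim \<nu> []) / fact (sum_list \<nu>))"
proof
  have "\<phi>L (sym_complexify (schur \<nu>)) = moment_value 1 z z' \<nu>"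
  proof (rule linear_functional_moment_value[where f = "\<lambda>\<nu>. sym_complexify (schur \<nu>)"])
    show "Vector_Spaces.linear sym_scale (*) \<phi>L"
      using assms(2) by (simp add: laguerre_moment_functional_def)
    show "\<phi>L (\<Sum>\<mu>\<in>subpartitions \<kappa>.
          sym_scale (expansion_coeff 1 z z' \<kappa> \<mu>) (sym_complexify (schur \<mu>)))
        = (if \<kappa> = [] then 1 else 0)" if "is_partition \<kappa>" for \<kappa>
      using assms(2) that
      by (simp add: laguerre_moment_functional_def laguerre_sym_def expansion_coeff_def)
  qed (fact assms(4))
  then show "\<phi>L (sym_complexify (schur \<nu>)) =
      content_prod z \<nu> [] * content_prod z' \<nu> [] *
      (of_nat (skew_dim \<nu> []) / fact (sum_list \<nu>))"
    by (simp add: moment_value_def)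
  have "\<phi>M (sym_complexify (frobenius_schur \<nu>)) = moment_value (\<xi> / (1 - \<xi>)) z z' \<nu>"
  proof (rule linear_functional_moment_value[where f = "\<lambda>\<nu>. sym_complexify (frobenius_schur \<nu>)"])
    show "Vector_Spaces.linear sym_scale (*) \<phi>M"
      using assms(3) by (simp add: meixner_moment_functional_def)
    show "\<phi>M (\<Sum>\<mu>\<in>subpartitions \<kappa>.
          sym_scale (expansion_coeff (\<xi> / (1 - \<xi>)) z z' \<kappa> \<mu>) (sym_complexify (frobenius_schur \<mu>)))
        = (if \<kappa> = [] then 1 else 0)" if "is_partition \<kappa>" for \<kappa>
      using assms(3) that
      by (simp only: meixner_moment_functional_def meixner_sym_def expansion_coeff_def)
  qed (fact assms(4))
  then show "\<phi>M (sym_complexify (frobenius_schur \<nu>)) =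
      (\<xi> / (1 - \<xi>)) ^ sum_list \<nu> *
      content_prod z \<nu> [] * content_prod z' \<nu> [] *
      (of_nat (skew_dim \<nu> []) / fact (sum_list \<nu>))"
    by (simp only: moment_value_def)
qed

end
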